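(* Let $g:\mathbb{R}\to\mathbb{R}$ be a derivator, $\mathbb{F}\in\{\mathbb{R},\mathbb{C}\}$, $\lambda\in\mathbb{F}\setminus\{0\}$ and $x_0\in\mathbb{R}$. If $1+\lambda\Delta g(x)\neq 0$ for all $x<x_0$, then there exists a Stieltjes-analytic extension of $\exp_g(\lambda;x_0)$ to the whole real line; that is, there is a Stieltjes-analytic function $F:\mathbb{R}\to\mathbb{F}$ such that $F(x)=\exp_g(\lambda;x_0)(x)$ for every $x$ at which the series $\sum_{n=0}^\infty\lambda^n\frac{g_{x_0,n}(x)}{n!}$ converges absolutely.
   Context: A derivator is a left-continuous non-decreasing function $g:\mathbb{R}\to\mathbb{R}$; $\Delta g(x)=g(x^+)-g(x)$. $\mu_g$ denotes its Lebesgue–Stieltjes measure, characterized on Borel sets by $\mu_g([a,b))=g(b)-g(a)$ for $a<b$. $g$-monomials centered at $t\in\mathbb{R}$: $g_{t,0}\equiv 1$ and, for $n\ge 1$, $g_{t,n}(x)=n\int_{[t,x)}g_{t,n-1}\,d\mu_g$ if $x\ge t$ and $g_{t,n}(x)=-n\int_{[x,t)}g_{t,n-1}\,d\mu_g$ if $x<t$. The exponential series associated to $g$ centered at $s$ is $\exp_g(\lambda;s)(x)=\sum_{n=0}^\infty\lambda^n\frac{g_{s,n}(x)}{n!}$, defined at those points $x$ where the sum converges absolutely. Stieltjes-analytic: for $\Omega\subset\mathbb{R}$ open in the usual topology, $f:\Omega\to\mathbb{F}$ is Stieltjes-analytic on $\Omega$ if for all $y\in\Omega$ there exist $\delta>0$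 and $t\in\mathbb{R}$ with $y\in(t,t+\delta)\subset\Omega$, and a sequence $\{a_n\}_{n=0}^\infty\subset\mathbb{F}$, such that $f(x)=\sum_{n=0}^\infty a_n g_{t,n}(x)$ for all $x\in(t,t+\delta)$, the sum converging absolutely. *)

theory Defs
  imports "HOL-Analysis.Analysis"
begin

definition derivator :: "(real \<Rightarrow> real) \<Rightarrow> bool" where
  "derivator g \<longleftrightarrow> mono g \<and> (\<forall>x. continuous (at_left x) g)"

definition jump :: "(real \<Rightarrow> real) \<Rightarrow> real \<Rightarrow> real" where
  "jump g x = Lim (at_right x) g - g x"

text \<open>The library's \<open>interval_measure\<close> is built from right-continuous functions and half-open
  intervals \<open>{a<..b}\<close>. Reflecting at the origin turns a left-continuous \<open>g\<close> into the
  right-continuous function \<open>\<lambda>x. - g (- x)\<close> and \<open>{a<..b}\<close> into \<open>{- b..<- a}\<close>.\<close>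

definition stieltjes_measure :: "(real \<Rightarrow> real) \<Rightarrow> real measure" where
  "stieltjes_measure g = distr (interval_measure (\<lambda>x. - g (- x))) borel uminus"

primrec g_monomial :: "(real \<Rightarrow> real) \<Rightarrow> real \<Rightarrow> nat \<Rightarrow> real \<Rightarrow> real" where
  "g_monomial g t 0 = (\<lambda>x. 1)"
| "g_monomial g t (Suc n) = (\<lambda>x.
     if t \<le> x
     then real (Suc n) * (LINT y:{t..<x}|stieltjes_measure g. g_monomial g t n y)
     else - real (Suc n) * (LINT y:{x..<t}|stieltjes_measure g. g_monomial g t n y))"

text \<open>The scalar type stands for the real or the complex field.\<close>

definition exp_g_term ::
    "(real \<Rightarrow> real) \<Rightarrow> 'a::{real_normed_field,banach} \<Rightarrow> real \<Rightarrow> real \<Rightarrow> nat \<Rightarrow> 'a" where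
  "exp_g_term g lam s x n = lam ^ n * (of_real (g_monomial g s n x) / fact n)"

definition exp_g_domain ::
    "(real \<Rightarrow> real) \<Rightarrow> 'a::{real_normed_field,banach} \<Rightarrow> real \<Rightarrow> real set" where
  "exp_g_domain g lam s = {x. summable (\<lambda>n. norm (exp_g_term g lam s x n))}"

text \<open>Only meaningful for \<open>x \<in> exp_g_domain g lam s\<close>.\<close>

definition exp_g ::
    "(real \<Rightarrow> real) \<Rightarrow> 'a::{real_normed_field,banach} \<Rightarrow> real \<Rightarrow> real \<Rightarrow> 'a" where
  "exp_g g lam s x = (\<Sum>n. exp_g_term g lam s x n)"

definition stieltjes_analytic_on ::
    "(real \<Rightarrow> real) \<Rightarrow> (real \<Rightarrow> 'a::{real_normed_field,banach}) \<Rightarrow> real set \<Rightarrow> bool" where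
  "stieltjes_analytic_on g f \<Omega> \<longleftrightarrow> open \<Omega> \<and>
     (\<forall>y\<in>\<Omega>. \<exists>\<delta>>0. \<exists>t. y \<in> {t<..<t + \<delta>} \<and> {t<..<t + \<delta>} \<subseteq> \<Omega> \<and>
       (\<exists>a :: nat \<Rightarrow> 'a. \<forall>x\<in>{t<..<t + \<delta>}.
          summable (\<lambda>n. norm (a n * of_real (g_monomial g t n x))) \<and>
          f x = (\<Sum>n. a n * of_real (g_monomial g t n x))))"

text \<open>Under the hypotheses on \<open>g\<close>, the above is the right measure and the limit in
  \<open>jump\<close> exists.\<close>

lemma sets_stieltjes_measure [simp]: "sets (stieltjes_measure g) = sets borel"
  by (simp add: stieltjes_measure_def)

lemma emeasure_stieltjes_measure_Ico:
  assumes g: "derivator g" and ab: "a \<le> b"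
  shows "emeasure (stieltjes_measure g) {a..<b} = ennreal (g b - g a)"
proof -
  have m: "mono g" and c: "\<And>x. continuous (at_left x) g"
    using g by (auto simp: derivator_def)
  have cont: "continuous (at_right x) (\<lambda>x. - g (- x))" for x
  proof -
    have "(g \<longlongrightarrow> g (- x)) (at_left (- x))"
      using c[of "- x"] by (simp add: continuous_within)
    then have "((\<lambda>x. g (- x)) \<longlongrightarrow> g (- x)) (at_right x)"
      by (simp add: filterlim_at_left_to_right)
    then show ?thesis
      by (simp add: continuous_within tendsto_minus)
  qed
  have vim: "uminus -` {a..<b} = {- b<..- a}"
    by (auto simp: minus_le_iff less_minus_iff le_minus_iff minus_less_iff)
  have "emeasure (stieltjes_measure g) {a..<b}
      = emeasure (interval_measure (\<lambda>x. - g (- x))) {- b<..- a}"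
    by (simp add: stieltjes_measure_def emeasure_distr vim)
  also have "\<dots> = ennreal (- g (- (- a)) - - g (- (- b)))"
    by (rule emeasure_interval_measure_Ioc) (use ab m cont in \<open>auto simp: mono_def\<close>)
  finally show ?thesis by simp
qed

lemma tendsto_jump:
  assumes "derivator g"
  shows "(g \<longlongrightarrow> g x + jump g x) (at_right x)"
proof -
  have m: "mono g" using assms by (simp add: derivator_def)
  have "(g \<longlongrightarrow> Inf (g ` ({x<..} \<inter> UNIV))) (at x within ({x<..} \<inter> UNIV))"
    by (rule Lim_right_bound[where K = "g x"]) (use m in \<open>auto simp: mono_def\<close>)
  then have "(g \<longlongrightarrow> Inf (g ` {x<..})) (at_right x)" by simp
  moreover from this have "Lim (at_right x) g = Inf (g ` {x<..})"
    by (intro tendsto_Lim) auto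
  ultimately show ?thesis by (simp add: jump_def)
qed

end

theory Submission
  imports Defs
begin

text \<open>Dividing the monomials by \<open>n!\<close> turns them into iterated oriented integrals, and additivity of
  the integral yields the binomial identity
  \<open>g\<^sub>t\<^sub>,\<^sub>n(x)/n! = (\<Sum>k\<le>n. g\<^sub>t\<^sub>,\<^sub>k(s)/k! * g\<^sub>s\<^sub>,\<^sub>n\<^sub>-\<^sub>k(x)/(n-k)!)\<close> for \<open>t\<close>, \<open>s\<close>, \<open>x\<close> in any order.
  By the Cauchy product, \<open>exp\<^sub>g(\<lambda>;t)(x) = exp\<^sub>g(\<lambda>;t)(s) * exp\<^sub>g(\<lambda>;s)(x)\<close> whenever both
  factors converge. Close to the right of its centre \<open>t\<close> the exponential is near
  \<open>1 + \<lambda> \<Delta>g(t)\<close>, and \<open>exp\<^sub>g(\<lambda>;t)(x)\<close> is near \<open>1\<close> when \<open>t\<close> approaches \<open>x\<close> from the left; so by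
  bisection the exponential converges everywhere to the right of its centre and vanishes at no
  point \<open>x \<le> x\<^sub>0\<close> there. Hence \<open>F(x) = exp\<^sub>g(\<lambda>;t)(x) / exp\<^sub>g(\<lambda>;t)(x\<^sub>0)\<close> does not depend on the choice
  of \<open>t \<le> min x x\<^sub>0\<close>, and moving \<open>t\<close> to the left makes \<open>F\<close> analytic near every point.\<close>

section \<open>Oriented Stieltjes integrals and divided monomials\<close>

text \<open>The sign for \<open>b < a\<close> makes the integral additive in its endpoints whatever
  their order, and merges both branches of \<open>g_monomial\<close> into a single
  recursion.\<close>

definition stieltjes_integral :: "(real \<Rightarrow> real) \<Rightarrow> real \<Rightarrow> real \<Rightarrow> (real \<Rightarrow> real) \<Rightarrow> real" where
  "stieltjes_integral g a b f =
     (if a \<le> b then LINT y:{a..<b}|stieltjes_measure g. f y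
      else - (LINT y:{b..<a}|stieltjes_measure g. f y))"

definition divided_monomial :: "(real \<Rightarrow> real) \<Rightarrow> real \<Rightarrow> nat \<Rightarrow> real \<Rightarrow> real" where
  "divided_monomial g t n x = g_monomial g t n x / fact n"

lemma divided_monomial_0 [simp]: "divided_monomial g t 0 x = 1"
  by (simp add: divided_monomial_def)

lemma divided_monomial_Suc:
  "divided_monomial g t (Suc n) x = stieltjes_integral g t x (divided_monomial g t n)"
proof -
  have "divided_monomial g t n = (\<lambda>x. g_monomial g t n x / fact n)"
    by (simp add: fun_eq_iff divided_monomial_def)
  then show ?thesis
    by (simp add: divided_monomial_def[of g t "Suc n"] stieltjes_integral_def del: of_nat_Suc)
qed

lemma divided_monomial_self: "n > 0 \<Longrightarrow> divided_monomial g t n t = 0"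
  by (cases n)
    (simp_all add: divided_monomial_Suc stieltjes_integral_def set_lebesgue_integral_def)

lemma exp_g_term_eq:
  "exp_g_term g lam t x n = lam ^ n * of_real (divided_monomial g t n x)"
  by (simp add: exp_g_term_def divided_monomial_def)

section \<open>The Stieltjes measure of intervals and points\<close>

lemma space_stieltjes_measure [simp]: "space (stieltjes_measure g) = UNIV"
  by (simp add: stieltjes_measure_def)

context
  fixes g :: "real \<Rightarrow> real"
  assumes g: "derivator g"
begin

lemma mono_derivator: "a \<le> b \<Longrightarrow> g a \<le> g b"
  using g by (auto simp: derivator_def mono_def)

lemma emeasure_Ico_finite: "emeasure (stieltjes_measure g) {a..<b} < \<infinity>"
proof (cases "a \<le> b")
  case True
  then show ?thesis by (simp add: emeasure_stieltjes_measure_Ico[OF g])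
qed simp

lemma measure_stieltjes_Ico:
  "a \<le> b \<Longrightarrow> measure (stieltjes_measure g) {a..<b} = g b - g a"
  by (simp add: measure_def emeasure_stieltjes_measure_Ico[OF g] mono_derivator)

text \<open>Serves the measurability of integrals in their moving endpoint.\<close>

lemma sigma_finite_stieltjes_measure: "sigma_finite_measure (stieltjes_measure g)"
proof
  have "x \<in> (\<Union>n::nat. {- real n..<real n})" for x :: real
  proof -
    obtain n :: nat where "\<bar>x\<bar> < real n" using reals_Archimedean2 by blast
    then show ?thesis by (intro UN_I[of n]) auto
  qed
  then have "(\<Union>n::nat. {- real n..<real n}) = (UNIV :: real set)" by blast
  then show "\<exists>A. countable A \<and> A \<subseteq> sets (stieltjes_measure g) \<and>
      \<Union>A = space (stieltjes_measure g) \<and> (\<forall>a\<in>A. emeasure (stieltjes_measure g) a \<noteq> \<infinity>)"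
    using emeasure_Ico_finite
    by (intro exI[of _ "range (\<lambda>n::nat. {- real n..<real n})"]) (auto simp: less_top)
qed

text \<open>Continuity from above along intervals \<open>[t, t + 1/(n+1))\<close> shrinking to
  \<open>t\<close>: their measures are increments of \<open>g\<close>, which tend to the jump by the
  right limit at \<open>t\<close>.\<close>

lemma measure_stieltjes_singleton: "measure (stieltjes_measure g) {t} = jump g t"
proof -
  have int: "(\<Inter>n. {t..<t + inverse (real (Suc n))}) = {t}"
  proof -
    have "x = t" if "\<forall>n. t \<le> x \<and> x < t + inverse (real (Suc n))" for x
    proof (rule ccontr)
      assume "x \<noteq> t"
      then have "0 < x - t" using that by force
      then obtain n where "inverse (real (Suc n)) < x - t" using reals_Archimedean by blast
      then show False using that[rule_format, of n] by linarith
    qed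
    then show ?thesis by auto
  qed
  have "(\<lambda>n. measure (stieltjes_measure g) {t..<t + inverse (real (Suc n))})
      \<longlonglongrightarrow> measure (stieltjes_measure g) (\<Inter>n. {t..<t + inverse (real (Suc n))})"
  proof (rule Lim_measure_decseq)
    show "decseq (\<lambda>n. {t..<t + inverse (real (Suc n))})"
      unfolding decseq_Suc_iff by (auto elim!: less_le_trans simp: field_simps)
    show "emeasure (stieltjes_measure g) {t..<t + inverse (real (Suc i))} \<noteq> \<infinity>" for i
      using emeasure_Ico_finite less_top by auto
  qed auto
  then have "(\<lambda>n. g (t + inverse (real (Suc n))) - g t)
      \<longlonglongrightarrow> measure (stieltjes_measure g) {t}"
    by (simp add: int measure_stieltjes_Ico del: of_nat_Suc)
  moreover have "(\<lambda>n. g (t + inverse (real (Suc n))) - g t) \<longlonglongrightarrow> (g t + jump g t) - g t"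
  proof (intro tendsto_diff tendsto_const filterlim_compose[OF tendsto_jump[OF g, of t]])
    have "(\<lambda>n. t + inverse (real (Suc n))) \<longlonglongrightarrow> t + 0"
      by (intro tendsto_intros LIMSEQ_inverse_real_of_nat)
    then show "filterlim (\<lambda>n. t + inverse (real (Suc n))) (at_right t) sequentially"
      unfolding filterlim_at by (simp del: of_nat_Suc)
  qed
  ultimately show ?thesis using LIMSEQ_unique by fastforce
qed

lemma jump_nonneg: "0 \<le> jump g t"
  by (simp flip: measure_stieltjes_singleton)

lemma measure_stieltjes_Ioo:
  assumes "t < x"
  shows "measure (stieltjes_measure g) {t<..<x} = g x - g t - jump g t"
proof -
  have "measure (stieltjes_measure g) ({t..<x} - {t})
      = measure (stieltjes_measure g) {t..<x} - measure (stieltjes_measure g) {t}"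
    using assms emeasure_Ico_finite[of t x] by (intro measure_Diff) (auto simp: less_top)
  moreover have "{t..<x} - {t} = {t<..<x}" by auto
  ultimately show ?thesis
    using assms by (simp add: measure_stieltjes_Ico measure_stieltjes_singleton)
qed

section \<open>Integrals over half-open intervals\<close>

lemma set_integral_Ico_const:
  fixes c :: real
  assumes "a \<le> b"
  shows "(LINT y:{a..<b}|stieltjes_measure g. c) = c * (g b - g a)"
  using assms emeasure_Ico_finite[of a b]
  by (simp add: set_lebesgue_integral_def measure_stieltjes_Ico)

lemma set_integrable_Ico:
  fixes f :: "real \<Rightarrow> real"
  assumes "f \<in> borel_measurable borel" "\<And>y. y \<in> {a..<b} \<Longrightarrow> \<bar>f y\<bar> \<le> B"
  shows "set_integrable (stieltjes_measure g) {a..<b} f"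
  unfolding set_integrable_def
proof (rule integrableI_bounded_set[where A = "{a..<b}" and B = B])
  have "f \<in> borel_measurable (stieltjes_measure g)"
    using assms(1) measurable_cong_sets[OF sets_stieltjes_measure refl] by blast
  then show "(\<lambda>x. indicator {a..<b} x *\<^sub>R f x) \<in> borel_measurable (stieltjes_measure g)"
    by (intro borel_measurable_scaleR borel_measurable_indicator) auto
qed (use assms(2) emeasure_Ico_finite in auto)

lemma stieltjes_integral_combine:
  assumes "\<And>a b. set_integrable (stieltjes_measure g) {a..<b} f"
  shows "stieltjes_integral g t x f = stieltjes_integral g t s f + stieltjes_integral g s x f"
proof -
  have *: "(LINT y:{a..<c}|stieltjes_measure g. f y)
      = (LINT y:{a..<b}|stieltjes_measure g. f y) + (LINT y:{b..<c}|stieltjes_measure g. f y)"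
    if "a \<le> b" "b \<le> c" for a b c
  proof -
    have "{a..<c} = {a..<b} \<union> {b..<c}" using that by auto
    moreover have "{a..<b} \<inter> {b..<c} = {}" by auto
    ultimately show ?thesis using assms by (simp add: set_integral_Un)
  qed
  show ?thesis
    unfolding stieltjes_integral_def
    \<comment> \<open>One instance for each of the six orderings of the three points.\<close>
    using *[of t s x] *[of t x s] *[of s t x] *[of s x t] *[of x s t] *[of x t s] by auto
qed

lemma borel_measurable_stieltjes_integral:
  assumes [measurable]: "f \<in> borel_measurable borel"
  shows "(\<lambda>x. stieltjes_integral g t x f) \<in> borel_measurable borel"
proof -
  interpret sigma_finite_measure "stieltjes_measure g" by (rule sigma_finite_stieltjes_measure)
  note [measurable_cong] = sets_stieltjes_measure
  have "{y. t \<le> y \<and> y < x} = {t..<x}" for x :: real by auto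
  \<comment> \<open>The endpoint \<open>x\<close> moves from the domain into the integrand, so that
    the integral over a fixed sigma-finite space depends measurably on the parameter
    \<open>x\<close>.\<close>
  moreover have "(\<lambda>x. LINT y|stieltjes_measure g. (if t \<le> y \<and> y < x then f y else 0))
      \<in> borel_measurable borel"
    by measurable
  moreover have "(\<lambda>x. LINT y|stieltjes_measure g. (if x \<le> y \<and> y < t then f y else 0))
      \<in> borel_measurable borel"
    by measurable
  ultimately show ?thesis
    unfolding stieltjes_integral_def set_lebesgue_integral_def
    by (simp add: indicator_def if_distrib cong: if_cong)
qed

text \<open>Bounding \<open>f\<close> on the symmetric interval \<open>[-R, R]\<close>, which
  contains both endpoints, serves both orientations with a single hypothesis.\<close>

lemma stieltjes_integral_bound:
  assumes "f \<in> borel_measurable borel" "\<And>y. \<bar>y\<bar> \<le> R \<Longrightarrow> \<bar>f y\<bar> \<le> B"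
    and "\<bar>t\<bar> \<le> R" "\<bar>x\<bar> \<le> R"
  shows "\<bar>stieltjes_integral g t x f\<bar> \<le> B * \<bar>g x - g t\<bar>"
proof -
  have *: "\<bar>LINT y:{a..<b}|stieltjes_measure g. f y\<bar> \<le> B * (g b - g a)"
    if "a \<le> b" "\<bar>a\<bar> \<le> R" "\<bar>b\<bar> \<le> R" for a b
  proof -
    have B: "\<bar>f y\<bar> \<le> B" if "y \<in> {a..<b}" for y
      using that assms(2)[of y] \<open>\<bar>a\<bar> \<le> R\<close> \<open>\<bar>b\<bar> \<le> R\<close> by auto
    have f: "set_integrable (stieltjes_measure g) {a..<b} f"
      by (rule set_integrable_Ico[OF assms(1) B])
    have const: "set_integrable (stieltjes_measure g) {a..<b} (\<lambda>_. c)" for c :: real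
      by (rule set_integrable_Ico[where B = "\<bar>c\<bar>"]) auto
    have "(LINT y:{a..<b}|stieltjes_measure g. f y) \<le> (LINT y:{a..<b}|stieltjes_measure g. B)"
      using B by (intro set_integral_mono f const) (auto simp: abs_le_iff)
    moreover have "(LINT y:{a..<b}|stieltjes_measure g. - B)
        \<le> (LINT y:{a..<b}|stieltjes_measure g. f y)"
      using B by (intro set_integral_mono f const) (fastforce simp: abs_le_iff)
    ultimately show ?thesis
      unfolding set_integral_Ico_const[OF \<open>a \<le> b\<close>] by (simp add: abs_le_iff)
  qed
  show ?thesis
  proof (cases "t \<le> x")
    case True
    then show ?thesis
      using *[of t x] assms(3,4) mono_derivator[of t x] by (simp add: stieltjes_integral_def)
  next
    case False
    then show ?thesis
      using *[of x t] assms(3,4) mono_derivator[of x t] by (simp add: stieltjes_integral_def)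
  qed
qed

section \<open>Integrability and the binomial identity for divided monomials\<close>

text \<open>Together the two properties give integrability over bounded intervals. They are proved
  jointly because the bound for the next monomial uses both for the previous one.\<close>

lemma divided_monomial_measurable_bounded:
  "divided_monomial g t n \<in> borel_measurable borel \<and>
   (\<forall>R. \<exists>B. \<forall>y. \<bar>y\<bar> \<le> R \<longrightarrow> \<bar>divided_monomial g t n y\<bar> \<le> B)"
proof (induction n)
  case 0
  have "divided_monomial g t 0 = (\<lambda>_. 1)" by auto
  then show ?case by auto
next
  case (Suc n)
  have eq: "divided_monomial g t (Suc n) = (\<lambda>x. stieltjes_integral g t x (divided_monomial g t n))"
    by (simp add: fun_eq_iff divided_monomial_Suc)
  have "\<exists>B. \<forall>y. \<bar>y\<bar> \<le> R \<longrightarrow> \<bar>divided_monomial g t (Suc n) y\<bar> \<le> B" for R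
  proof -
    \<comment> \<open>The radius is enlarged to reach the centre \<open>t\<close>, where the
      integral starts.\<close>
    define R' where "R' = max R \<bar>t\<bar>"
    obtain B where B: "\<And>y. \<bar>y\<bar> \<le> R' \<Longrightarrow> \<bar>divided_monomial g t n y\<bar> \<le> B"
      using Suc by blast
    have "0 \<le> B" using B[of t] by (auto simp: R'_def)
    have "\<bar>divided_monomial g t (Suc n) y\<bar> \<le> B * (g R' - g (- R'))" if "\<bar>y\<bar> \<le> R" for y
    proof -
      have "\<bar>divided_monomial g t (Suc n) y\<bar> \<le> B * \<bar>g y - g t\<bar>"
        unfolding eq using Suc B that
        by (intro stieltjes_integral_bound[where R = R']) (auto simp: R'_def)
      also have "\<bar>g y - g t\<bar> \<le> g R' - g (- R')"
      proof -
        have "\<bar>y\<bar> \<le> R'" "\<bar>t\<bar> \<le> R'" using that by (auto simp: R'_def)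
        then have "g y \<le> g R'" "g (- R') \<le> g y" "g t \<le> g R'" "g (- R') \<le> g t"
          by (auto intro!: mono_derivator)
        then show ?thesis by linarith
      qed
      finally show ?thesis using \<open>0 \<le> B\<close> by (simp add: mult_left_mono)
    qed
    then show ?thesis by blast
  qed
  then show ?case using Suc borel_measurable_stieltjes_integral by (simp add: eq)
qed

lemma set_integrable_divided_monomial:
  "set_integrable (stieltjes_measure g) {a..<b} (divided_monomial g t n)"
proof -
  obtain B where "\<And>y. \<bar>y\<bar> \<le> max \<bar>a\<bar> \<bar>b\<bar> \<Longrightarrow> \<bar>divided_monomial g t n y\<bar> \<le> B"
    using divided_monomial_measurable_bounded by meson
  then show ?thesis
    using divided_monomial_measurable_bounded
    by (intro set_integrable_Ico[where B = B]) auto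
qed

lemma stieltjes_integral_sum:
  assumes "finite I" "\<And>i a b. i \<in> I \<Longrightarrow> set_integrable (stieltjes_measure g) {a..<b} (f i)"
  shows "stieltjes_integral g t x (\<lambda>y. \<Sum>i\<in>I. c i * f i y)
      = (\<Sum>i\<in>I. c i * stieltjes_integral g t x (f i))"
proof -
  have "(LINT y:{a..<b}|stieltjes_measure g. (\<Sum>i\<in>I. c i * f i y))
      = (\<Sum>i\<in>I. c i * (LINT y:{a..<b}|stieltjes_measure g. f i y))" for a b
    using assms by (simp add: set_lebesgue_integral_def set_integrable_def sum_distrib_left
        Bochner_Integration.integral_sum mult.left_commute[of "indicator _ _"])
  then show ?thesis by (simp add: stieltjes_integral_def sum_negf)
qed

text \<open>Split the integral from \<open>t\<close> to \<open>x\<close> at \<open>s\<close>. The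
  part up to \<open>s\<close> is the summand \<open>k = Suc n\<close>; the part from
  \<open>s\<close> on raises by one the degree of each second factor of the expansion for
  \<open>n\<close>. That expansion is used under the integral sign, hence the induction for
  arbitrary \<open>x\<close>.\<close>

lemma divided_monomial_binomial:
  "divided_monomial g t n x = (\<Sum>k\<le>n. divided_monomial g t k s * divided_monomial g s (n - k) x)"
proof (induction n arbitrary: x)
  case (Suc n)
  have "divided_monomial g t (Suc n) x
      = divided_monomial g t (Suc n) s + stieltjes_integral g s x (divided_monomial g t n)"
    unfolding divided_monomial_Suc
    by (rule stieltjes_integral_combine) (rule set_integrable_divided_monomial)
  also have "divided_monomial g t n
      = (\<lambda>y. \<Sum>k\<le>n. divided_monomial g t k s * divided_monomial g s (n - k) y)"
    using Suc by blast
  also have "stieltjes_integral g s x \<dots>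
      = (\<Sum>k\<le>n. divided_monomial g t k s * divided_monomial g s (Suc n - k) x)"
    by (simp add: stieltjes_integral_sum set_integrable_divided_monomial Suc_diff_le
        divided_monomial_Suc)
  finally show ?case by simp
qed simp

section \<open>Multiplicativity of the exponential\<close>

text \<open>The three points may come in any order; going from a centre to a point on its left and
  back later yields reciprocals.\<close>

lemma exp_g_mult:
  fixes lam :: "'a::{real_normed_field,banach}"
  assumes "s \<in> exp_g_domain g lam t" "x \<in> exp_g_domain g lam s"
  shows "x \<in> exp_g_domain g lam t" "exp_g g lam t x = exp_g g lam t s * exp_g g lam s x"
proof -
  have conv: "(\<Sum>k\<le>n. exp_g_term g lam t s k * exp_g_term g lam s x (n - k))
      = exp_g_term g lam t x n" for n
  proof -
    have "(\<Sum>k\<le>n. exp_g_term g lam t s k * exp_g_term g lam s x (n - k))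
      = (\<Sum>k\<le>n. lam ^ n * of_real (divided_monomial g t k s * divided_monomial g s (n - k) x))"
    proof (rule sum.cong)
      fix k assume "k \<in> {..n}"
      then have "lam ^ n = lam ^ k * lam ^ (n - k)" by (simp flip: power_add)
      then show "exp_g_term g lam t s k * exp_g_term g lam s x (n - k)
        = lam ^ n * of_real (divided_monomial g t k s * divided_monomial g s (n - k) x)"
        by (simp add: exp_g_term_eq)
    qed simp
    also have "\<dots> = lam ^ n * of_real (divided_monomial g t n x)"
      by (subst divided_monomial_binomial[of t n x s]) (simp add: sum_distrib_left)
    finally show ?thesis by (simp add: exp_g_term_eq)
  qed
  have a: "summable (\<lambda>n. norm (exp_g_term g lam t s n))"
    and b: "summable (\<lambda>n. norm (exp_g_term g lam s x n))"
    using assms by (auto simp: exp_g_domain_def)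
  \<comment> \<open>The Cauchy product of the two series of norms dominates the series of norms for
    \<open>x\<close> centred at \<open>t\<close>.\<close>
  have "summable (\<lambda>n. \<Sum>k\<le>n. norm (exp_g_term g lam t s k) * norm (exp_g_term g lam s x (n - k)))"
    using a b by (intro summable_Cauchy_product) auto
  moreover have "norm (exp_g_term g lam t x n)
      \<le> (\<Sum>k\<le>n. norm (exp_g_term g lam t s k) * norm (exp_g_term g lam s x (n - k)))" for n
    unfolding conv[symmetric] by (intro sum_norm_le) (simp add: norm_mult)
  ultimately show "x \<in> exp_g_domain g lam t"
    unfolding exp_g_domain_def by (auto intro: summable_comparison_test'[where N = 0])
  show "exp_g g lam t x = exp_g g lam t s * exp_g g lam s x"
    using Cauchy_product[OF a b] by (simp add: exp_g_def conv)
qed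

lemma exp_g_self:
  fixes lam :: "'a::{real_normed_field,banach}"
  shows "t \<in> exp_g_domain g lam t" "exp_g g lam t t = 1"
proof -
  have *: "exp_g_term g lam t t n = (if n = 0 then 1 else 0)" for n
    by (simp add: exp_g_term_eq divided_monomial_self)
  have "(\<lambda>n. norm (exp_g_term g lam t t n)) = (\<lambda>n. if n = 0 then 1 else 0)"
    by (simp add: * fun_eq_iff)
  then show "t \<in> exp_g_domain g lam t" by (simp add: exp_g_domain_def)
  have "exp_g g lam t t = (\<Sum>n\<in>{0}. exp_g_term g lam t t n)"
    unfolding exp_g_def by (rule suminf_finite) (auto simp: *)
  then show "exp_g g lam t t = 1" by (simp add: *)
qed

section \<open>Geometric estimates to the right of the centre\<close>

lemma jump_le_increment: "t < x \<Longrightarrow> jump g t \<le> g x - g t"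
  using measure_stieltjes_Ioo[of t x] measure_nonneg[of "stieltjes_measure g" "{t<..<x}"] by linarith

lemma divided_monomial_1:
  assumes "t < x"
  shows "divided_monomial g t (Suc 0) x = g x - g t"
proof -
  have "divided_monomial g t 0 = (\<lambda>_. 1)" by auto
  then show ?thesis
    using assms by (simp add: divided_monomial_Suc stieltjes_integral_def set_integral_Ico_const)
qed

text \<open>The atom at the centre contributes only to the first monomial, because the
  higher ones vanish there; so the jump does not enter the ratio of the geometric bound.\<close>

lemma divided_monomial_bound:
  assumes "t < x"
  shows "0 \<le> divided_monomial g t (Suc n) x"
    and "divided_monomial g t (Suc n) x \<le> (g x - g t) * (g x - g t - jump g t) ^ n"
proof -
  have "0 \<le> divided_monomial g t (Suc n) x \<and>
      divided_monomial g t (Suc n) x \<le> (g x - g t) * (g x - g t - jump g t) ^ n"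
    using assms
  proof (induction n arbitrary: x)
    case 0
    then show ?case using divided_monomial_1 mono_derivator[of t x] by simp
  next
    case (Suc n)
    let ?C = "(g x - g t) * (g x - g t - jump g t) ^ n"
    have nn: "0 \<le> divided_monomial g t (Suc n) y" if "y \<in> {t..<x}" for y
      using that Suc.IH[of y] divided_monomial_self[of "Suc n" g t] by (cases "y = t") auto
    have le: "divided_monomial g t (Suc n) y \<le> indicator {t<..<x} y * ?C" if y: "y \<in> {t..<x}" for y
    proof (cases "y = t")
      case False
      then have "divided_monomial g t (Suc n) y \<le> (g y - g t) * (g y - g t - jump g t) ^ n"
        using y Suc.IH[of y] by auto
      also have "\<dots> \<le> ?C"
        using False y jump_le_increment[of t y] mono_derivator[of t y] mono_derivator[of y x]
        by (intro mult_mono power_mono) auto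
      finally show ?thesis using False y by auto
    qed (simp add: divided_monomial_self)
    have eq: "divided_monomial g t (Suc (Suc n)) x
        = (LINT y:{t..<x}|stieltjes_measure g. divided_monomial g t (Suc n) y)"
      using Suc.prems by (simp add: divided_monomial_Suc[of g t "Suc n"] stieltjes_integral_def)
    have fin: "emeasure (stieltjes_measure g) {t<..<x} < \<infinity>"
      by (rule le_less_trans[OF emeasure_mono emeasure_Ico_finite[of t x]]) auto
    have "(LINT y:{t..<x}|stieltjes_measure g. divided_monomial g t (Suc n) y)
        \<le> (LINT y|stieltjes_measure g. indicator {t<..<x} y * ?C)"
      unfolding set_lebesgue_integral_def
    proof (rule integral_mono)
      show "integrable (stieltjes_measure g)
          (\<lambda>y. indicator {t..<x} y *\<^sub>R divided_monomial g t (Suc n) y)"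
        using set_integrable_divided_monomial by (simp add: set_integrable_def)
      show "integrable (stieltjes_measure g) (\<lambda>y. indicator {t<..<x} y * ?C)"
        using fin by (intro integrable_mult_left integrable_real_indicator) auto
      show "indicator {t..<x} y *\<^sub>R divided_monomial g t (Suc n) y \<le> indicator {t<..<x} y * ?C" for y
        using le[of y] by (auto simp: indicator_def split: if_splits)
    qed
    also have "\<dots> = ?C * (g x - g t - jump g t)"
      using fin measure_stieltjes_Ioo[OF Suc.prems] by simp
    finally have "divided_monomial g t (Suc (Suc n)) x \<le> ?C * (g x - g t - jump g t)"
      unfolding eq .
    moreover have "0 \<le> divided_monomial g t (Suc (Suc n)) x"
      unfolding eq set_lebesgue_integral_def
      using nn by (intro integral_nonneg_AE AE_I2) (auto simp: indicator_def)
    ultimately show ?case by (simp add: mult_ac)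
  qed
  then show "0 \<le> divided_monomial g t (Suc n) x"
    and "divided_monomial g t (Suc n) x \<le> (g x - g t) * (g x - g t - jump g t) ^ n"
    by auto
qed

text \<open>The first two terms of the series are \<open>1 + lam * D\<close>; the rest is dominated
  by a geometric series of ratio \<open>norm lam * d\<close>. The error carries both
  \<open>D\<close> and \<open>d\<close>: the factor \<open>d\<close> vanishes when \<open>x\<close>
  approaches \<open>t\<close> from the right, and both vanish when \<open>t\<close> approaches
  \<open>x\<close> from the left.\<close>

lemma exp_g_local:
  fixes lam :: "'a::{real_normed_field,banach}"
  assumes "t < x" and small: "norm lam * (g x - g t - jump g t) \<le> 1/2"
  defines "D \<equiv> g x - g t" and "d \<equiv> g x - g t - jump g t"
  shows "x \<in> exp_g_domain g lam t"
    and "norm (exp_g g lam t x - (1 + lam * of_real D)) \<le> 2 * (norm lam)\<^sup>2 * D * d"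
proof -
  let ?f = "exp_g_term g lam t x"
  define r where "r = norm lam * d"
  have d: "0 \<le> d" "0 \<le> D"
    using jump_le_increment[OF assms(1)] mono_derivator[of t x] assms(1) by (auto simp: d_def D_def)
  have r: "0 \<le> r" "r \<le> 1/2" using small d by (auto simp: r_def d_def)
  have bound: "norm (?f (Suc n)) \<le> norm lam * D * r ^ n" for n
  proof -
    have "norm (?f (Suc n)) \<le> norm lam ^ Suc n * (D * d ^ n)"
      using divided_monomial_bound[OF assms(1), of n]
      by (auto simp: exp_g_term_eq norm_mult norm_power D_def d_def intro!: mult_left_mono)
    then show ?thesis by (simp add: r_def power_mult_distrib mult_ac)
  qed
  have geo: "summable (\<lambda>n. norm lam * D * r ^ n)"
    using r by (intro summable_mult summable_geometric) auto
  have "summable (\<lambda>n. norm (?f (Suc n)))"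
    using bound by (intro summable_comparison_test'[OF geo, of 0]) auto
  then have sn: "summable (\<lambda>n. norm (?f n))" by (rule summable_Suc_iff[THEN iffD1])
  then show "x \<in> exp_g_domain g lam t" by (simp add: exp_g_domain_def)
  have s: "summable ?f" using sn by (rule summable_norm_cancel)
  have "exp_g g lam t x = (\<Sum>n. ?f (n + 2)) + (\<Sum>i<2. ?f i)"
    unfolding exp_g_def by (rule suminf_split_initial_segment[OF s])
  moreover have "(\<Sum>i<2. ?f i) = 1 + lam * of_real D"
    using divided_monomial_1[OF assms(1)]
    by (simp add: numeral_2_eq_2 exp_g_term_eq D_def)
  ultimately have "norm (exp_g g lam t x - (1 + lam * of_real D)) = norm (\<Sum>n. ?f (n + 2))"
    by simp
  also have "\<dots> \<le> (\<Sum>n. norm lam * D * r * r ^ n)"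
  proof (rule norm_suminf_le)
    show "norm (?f (n + 2)) \<le> norm lam * D * r * r ^ n" for n
      using bound[of "Suc n"] by (simp add: mult_ac)
    show "summable (\<lambda>n. norm lam * D * r * r ^ n)"
      using r by (intro summable_mult summable_geometric) auto
  qed
  also have "\<dots> = norm lam * D * r * (1 / (1 - r))"
    using r by (simp add: suminf_mult summable_geometric suminf_geometric)
  \<comment> \<open>Since \<open>r \<le> 1/2\<close>, the geometric sum \<open>1 / (1 - r)\<close>
    is at most 2.\<close>
  also have "\<dots> \<le> norm lam * D * r * 2"
    using r d by (intro mult_left_mono) (auto simp: field_simps)
  finally show "norm (exp_g g lam t x - (1 + lam * of_real D)) \<le> 2 * (norm lam)\<^sup>2 * D * d"
    by (simp add: r_def power2_eq_square mult_ac)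
qed

section \<open>Convergence and non-vanishing, first locally and then globally\<close>

text \<open>As \<open>x\<close> decreases to \<open>t\<close>, \<open>d\<close> tends to 0 and
  \<open>D\<close> to the jump at \<open>t\<close>, so the exponential tends to
  \<open>?z\<close>.\<close>

lemma exp_g_right_of_centre:
  fixes lam :: "'a::{real_normed_field,banach}"
  shows "\<exists>e>0. \<forall>x. t < x \<and> x < t + e \<longrightarrow> x \<in> exp_g_domain g lam t \<and>
    (1 + lam * of_real (jump g t) \<noteq> 0 \<longrightarrow> exp_g g lam t x \<noteq> 0)"
proof -
  let ?z = "1 + lam * of_real (jump g t)"
  define D where "D x = g x - g t" for x
  define d where "d x = g x - g t - jump g t" for x
  have "(d \<longlongrightarrow> g t + jump g t - g t - jump g t) (at_right t)"
    unfolding d_def by (intro tendsto_intros tendsto_jump[OF g])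
  then have d: "(d \<longlongrightarrow> 0) (at_right t)" by simp
  have D: "(D \<longlongrightarrow> g t + jump g t - g t) (at_right t)"
    unfolding D_def by (intro tendsto_intros tendsto_jump[OF g])
  have "((\<lambda>x. norm lam * d x) \<longlongrightarrow> norm lam * 0) (at_right t)"
    by (intro tendsto_intros d)
  then have 1: "eventually (\<lambda>x. norm lam * d x < 1/2) (at_right t)"
    by (rule order_tendstoD) simp
  \<comment> \<open>The first summand is the distance from \<open>?z\<close> to
    \<open>1 + lam * D\<close>, the second the error in \<open>exp_g_local\<close>. Once their sum
    is below \<open>norm ?z\<close>, the exponential cannot vanish.\<close>
  have "((\<lambda>x. norm lam * d x + 2 * (norm lam)\<^sup>2 * D x * d x) \<longlongrightarrow>
      norm lam * 0 + 2 * (norm lam)\<^sup>2 * (g t + jump g t - g t) * 0) (at_right t)"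
    by (intro tendsto_intros d D)
  then have 2: "eventually (\<lambda>x. ?z \<noteq> 0 \<longrightarrow>
      norm lam * d x + 2 * (norm lam)\<^sup>2 * D x * d x < norm ?z) (at_right t)"
    using order_tendstoD(2) by (cases "?z = 0") fastforce+
  have "eventually (\<lambda>x. x \<in> exp_g_domain g lam t \<and> (?z \<noteq> 0 \<longrightarrow> exp_g g lam t x \<noteq> 0)) (at_right t)"
    using 1 2 eventually_at_right_less
  proof eventually_elim
    case (elim x)
    note * = exp_g_local[OF elim(3), of lam, folded d_def D_def]
    have "exp_g g lam t x \<noteq> 0" if "?z \<noteq> 0"
    proof
      assume "exp_g g lam t x = 0"
      then have "norm (1 + lam * of_real (D x)) \<le> 2 * (norm lam)\<^sup>2 * D x * d x"
        using *(2)[OF less_imp_le[OF elim(1)]] by (simp only: diff_0 norm_minus_cancel)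
      moreover have "0 \<le> d x" using jump_le_increment[OF elim(3)] by (simp add: d_def)
      then have "norm (?z - (1 + lam * of_real (D x))) = norm lam * d x"
        by (simp add: d_def D_def norm_mult flip: right_diff_distrib of_real_diff)
      moreover have "norm ?z \<le> norm (1 + lam * of_real (D x)) + norm (?z - (1 + lam * of_real (D x)))"
        by (rule norm_triangle_sub)
      ultimately show False using elim(2) that by linarith
    qed
    then show ?case using *(1) elim(1) by simp
  qed
  then show ?thesis unfolding eventually_at_right_field
    by (metis add.commute diff_add_cancel diff_gt_0_iff_gt)
qed

text \<open>Left-continuity of \<open>g\<close> at \<open>x\<close> sends the whole increment to 0
  as \<open>t\<close> increases to \<open>x\<close>, and the jump at \<open>t\<close> with it, so
  the exponential tends to 1.\<close>

lemma exp_g_left_of_point: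
  fixes lam :: "'a::{real_normed_field,banach}"
  shows "\<exists>e>0. \<forall>t. x - e < t \<and> t < x \<longrightarrow> x \<in> exp_g_domain g lam t \<and> exp_g g lam t x \<noteq> 0"
proof -
  define D where "D t = g x - g t" for t
  have "(g \<longlongrightarrow> g x) (at_left x)" using g by (simp add: derivator_def continuous_within)
  then have "(D \<longlongrightarrow> g x - g x) (at_left x)"
    unfolding D_def by (intro tendsto_intros)
  then have D: "(D \<longlongrightarrow> 0) (at_left x)" by simp
  have "((\<lambda>t. norm lam * D t) \<longlongrightarrow> norm lam * 0) (at_left x)"
    by (intro tendsto_intros D)
  then have 1: "eventually (\<lambda>t. norm lam * D t < 1/2) (at_left x)"
    by (rule order_tendstoD) simp
  have "((\<lambda>t. norm lam * D t + 2 * (norm lam)\<^sup>2 * D t * D t) \<longlongrightarrow>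
      norm lam * 0 + 2 * (norm lam)\<^sup>2 * 0 * 0) (at_left x)"
    by (intro tendsto_intros D)
  then have 2: "eventually (\<lambda>t. norm lam * D t + 2 * (norm lam)\<^sup>2 * D t * D t < 1) (at_left x)"
    by (rule order_tendstoD) simp
  have 3: "eventually (\<lambda>t. t < x) (at_left x)" by (simp add: eventually_at_filter)
  have "eventually (\<lambda>t. x \<in> exp_g_domain g lam t \<and> exp_g g lam t x \<noteq> 0) (at_left x)"
    using 1 2 3
  proof eventually_elim
    case (elim t)
    have D0: "0 \<le> D t" using mono_derivator[of t x] elim(3) by (simp add: D_def)
    have dD: "g x - g t - jump g t \<le> D t" using jump_nonneg[of t] by (simp add: D_def)
    have "norm lam * (g x - g t - jump g t) \<le> norm lam * D t"
      using dD by (intro mult_left_mono) auto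
    then have small: "norm lam * (g x - g t - jump g t) \<le> 1/2" using elim(1) by linarith
    note * = exp_g_local[OF elim(3) small, folded D_def]
    have "exp_g g lam t x \<noteq> 0"
    proof
      assume "exp_g g lam t x = 0"
      then have "norm (1 + lam * of_real (D t)) \<le> 2 * (norm lam)\<^sup>2 * D t * (D t - jump g t)"
        using *(2) unfolding D_def by (simp only: diff_0 norm_minus_cancel)
      also have "\<dots> \<le> 2 * (norm lam)\<^sup>2 * D t * D t"
        using D0 jump_nonneg[of t] by (intro mult_left_mono) auto
      finally have "norm (1 + lam * of_real (D t)) \<le> 2 * (norm lam)\<^sup>2 * D t * D t" .
      moreover have "norm (lam * of_real (D t)) = norm lam * D t"
        using D0 by (simp add: norm_mult)
      moreover have "1 - norm (lam * of_real (D t)) \<le> norm (1 + lam * of_real (D t))"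
        using norm_diff_ineq[of 1 "lam * of_real (D t)"] by simp
      ultimately show False using elim(2) by linarith
    qed
    then show ?case using *(1) by simp
  qed
  then obtain b where "b < x" "\<forall>t>b. t < x \<longrightarrow> x \<in> exp_g_domain g lam t \<and> exp_g g lam t x \<noteq> 0"
    unfolding eventually_at_left_field by blast
  then show ?thesis by (intro exI[of _ "x - b"]) auto
qed

text \<open>Bisection on the interval: \<open>exp_g_mult\<close> glues adjacent intervals, and a
  short interval around \<open>y\<close> is cut at \<open>y\<close> into a left and a right piece,
  each covered by a local lemma. The half-open range of the jump condition matches the integrals
  over \<open>[t, x)\<close> and concatenates exactly.\<close>

lemma exp_g_domain_nonzero:
  fixes lam :: "'a::{real_normed_field,banach}"
  assumes "t \<le> x"
  shows "x \<in> exp_g_domain g lam t \<and>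
    ((\<forall>y\<in>{t..<x}. 1 + lam * of_real (jump g y) \<noteq> 0) \<longrightarrow> exp_g g lam t x \<noteq> 0)"
    (is "?P t x")
  using assms
proof (induction rule: Bolzano)
  case (trans a b c)
  then show ?case by (auto simp: exp_g_mult[of b lam a c])
next
  case (local y)
  obtain e1 where e1: "e1 > 0" "\<And>b. y < b \<Longrightarrow> b < y + e1 \<Longrightarrow> b \<in> exp_g_domain g lam y \<and>
      (1 + lam * of_real (jump g y) \<noteq> 0 \<longrightarrow> exp_g g lam y b \<noteq> 0)"
    using exp_g_right_of_centre by blast
  obtain e2 where e2: "e2 > 0" "\<And>a. y - e2 < a \<Longrightarrow> a < y \<Longrightarrow>
      y \<in> exp_g_domain g lam a \<and> exp_g g lam a y \<noteq> 0"
    using exp_g_left_of_point by blast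
  have "?P a b" if "a \<le> y" "y \<le> b" "b - a < min e1 e2" for a b
  proof -
    have "?P a y" using that e2(2)[of a] by (cases "a = y") (auto simp: exp_g_self)
    \<comment> \<open>For \<open>y < b\<close> the point \<open>y\<close> belongs to
      \<open>{y..<b}\<close>, so the premise inside \<open>?P y b\<close> supplies the jump
      condition at \<open>y\<close>.\<close>
    moreover have "?P y b" using that e1(2)[of b] by (cases "y = b") (auto simp: exp_g_self)
    ultimately show ?thesis using that by (auto simp: exp_g_mult[of y lam a b])
  qed
  then show ?case using e1(1) e2(1) by (intro exI[of _ "min e1 e2"]) auto
qed

section \<open>Construction of the extension\<close>

text \<open>The scalar type stays abstract so that the real and the complex case are instances. The
  jumps left of \<open>x0\<close> matter because every denominator is an exponential evaluated at a
  point not beyond \<open>x0\<close>.\<close>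

lemma exp_g_analytic_extension:
  fixes lam :: "'a::{real_normed_field,banach}"
  assumes nz: "\<forall>y<x0. 1 + lam * of_real (jump g y) \<noteq> 0"
  shows "\<exists>F. stieltjes_analytic_on g F UNIV \<and> (\<forall>x\<in>exp_g_domain g lam x0. F x = exp_g g lam x0 x)"
proof -
  \<comment> \<open>The centre \<open>min x x0\<close> lies left of or at both points, so both
    series converge.\<close>
  define F where "F x = exp_g g lam (min x x0) x / exp_g g lam (min x x0) x0" for x
  have dom: "x \<in> exp_g_domain g lam t" if "t \<le> x" for t x
    using that exp_g_domain_nonzero by blast
  have nonzero: "exp_g g lam t x \<noteq> 0" if "t \<le> x" "x \<le> x0" for t x
    using that exp_g_domain_nonzero[OF that(1), of lam] nz by auto
  have F: "F x = exp_g g lam t x / exp_g g lam t x0" if "t \<le> x" "t \<le> x0" for t x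
  proof -
    let ?m = "min x x0"
    \<comment> \<open>Moving the centre from \<open>?m\<close> to \<open>t\<close> multiplies
      numerator and denominator by the same factor, nonzero because
      \<open>?m \<le> x0\<close>.\<close>
    have *: "exp_g g lam t y = exp_g g lam t ?m * exp_g g lam ?m y" if "?m \<le> y" for y
      using that \<open>t \<le> x\<close> \<open>t \<le> x0\<close> by (intro exp_g_mult(2) dom) auto
    have "exp_g g lam t ?m \<noteq> 0" using that by (intro nonzero) auto
    then show ?thesis unfolding F_def *[of x, OF min.cobounded1] *[of x0, OF min.cobounded2]
      by simp
  qed
  have "F x = exp_g g lam x0 x" if "x \<in> exp_g_domain g lam x0" for x
  proof (cases "x0 \<le> x")
    case True
    then show ?thesis using F[of x0 x] by (simp add: exp_g_self)
  next
    case False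
    \<comment> \<open>Left of \<open>x0\<close>, the path from \<open>x0\<close> to \<open>x\<close>
      and back shows that the series, where it converges, is the reciprocal of
      \<open>exp_g g lam x x0\<close>.\<close>
    then have "exp_g g lam x0 x * exp_g g lam x x0 = 1"
      using exp_g_mult(2)[OF that dom, of x0] by (simp add: exp_g_self)
    moreover have "F x = 1 / exp_g g lam x x0" using False F[of x x] by (simp add: exp_g_self)
    moreover have "exp_g g lam x x0 \<noteq> 0" using False nonzero by simp
    ultimately show ?thesis by (simp add: nonzero_eq_divide_eq[symmetric])
  qed
  moreover have "stieltjes_analytic_on g F UNIV"
    unfolding stieltjes_analytic_on_def
  proof (intro conjI ballI)
    fix y :: real
    \<comment> \<open>Subtracting 1 puts the centre strictly left of both \<open>y\<close> and
      \<open>x0\<close>; the width \<open>y - t + 1\<close> chosen below then makes \<open>y\<close>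
      an interior point.\<close>
    define t where "t = min y x0 - 1"
    let ?a = "\<lambda>n. lam ^ n / (fact n * exp_g g lam t x0)"
    have eq: "?a n * of_real (g_monomial g t n x) = exp_g_term g lam t x n / exp_g g lam t x0" for n x
      by (simp add: exp_g_term_def)
    have "summable (\<lambda>n. norm (?a n * of_real (g_monomial g t n x))) \<and>
        F x = (\<Sum>n. ?a n * of_real (g_monomial g t n x))" if "t < x" for x
    proof -
      have s: "summable (\<lambda>n. norm (exp_g_term g lam t x n))"
        using dom[of t x] that by (simp add: exp_g_domain_def)
      have "F x = exp_g g lam t x / exp_g g lam t x0"
        using that by (intro F) (auto simp: t_def)
      then show ?thesis
        unfolding eq using s
        by (simp add: norm_divide summable_divide exp_g_def suminf_divide summable_norm_cancel)
    qed
    then show "\<exists>\<delta>>0. \<exists>t. y \<in> {t<..<t + \<delta>} \<and> {t<..<t + \<delta>} \<subseteq> UNIV \<and>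
       (\<exists>a :: nat \<Rightarrow> 'a. \<forall>x\<in>{t<..<t + \<delta>}.
          summable (\<lambda>n. norm (a n * of_real (g_monomial g t n x))) \<and>
          F x = (\<Sum>n. a n * of_real (g_monomial g t n x)))"
      by (intro exI[of _ "y - t + 1"] conjI exI[of _ t] exI[of _ ?a]) (auto simp: t_def)
  qed simp
  ultimately show ?thesis by blast
qed

end

theorem theorem5p9:
  fixes g :: "real \<Rightarrow> real" and x\<^sub>0 :: real
  assumes "derivator g"
  shows "(\<forall>lam::real. lam \<noteq> 0 \<longrightarrow> (\<forall>x<x\<^sub>0. 1 + lam * jump g x \<noteq> 0) \<longrightarrow>
            (\<exists>F :: real \<Rightarrow> real. stieltjes_analytic_on g F UNIV \<and>
              (\<forall>x\<in>exp_g_domain g lam x\<^sub>0. F x = exp_g g lam x\<^sub>0 x))) \<and>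
         (\<forall>lam::complex. lam \<noteq> 0 \<longrightarrow> (\<forall>x<x\<^sub>0. 1 + lam * complex_of_real (jump g x) \<noteq> 0) \<longrightarrow>
            (\<exists>F :: real \<Rightarrow> complex. stieltjes_analytic_on g F UNIV \<and>
              (\<forall>x\<in>exp_g_domain g lam x\<^sub>0. F x = exp_g g lam x\<^sub>0 x)))"
  using exp_g_analytic_extension[OF assms, where ?'a = real]
    exp_g_analytic_extension[OF assms, where ?'a = complex]
  by simp

end
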